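(* Let $X$ be a finite set with $|X|=n\geq 3$, let $\tau$ be the discrete topology on $X$, and let $G_\tau$ be the discrete topological graph of $X$. Then $G_\tau$ has an induced subgraph isomorphic to the null graph $N_n$.
   Context: For a non-empty set $X$ with the discrete topology $\tau$ (so $\tau$ is the family of all subsets of $X$), the discrete topological graph $G_\tau=(V,E)$ is the simple undirected graph with vertex set $V=\{A\in\tau : A\neq\emptyset,\ A\neq X\}$ in which two vertices $A,B$ are adjacent if and only if $A\cap B=\emptyset$. The null graph $N_n$ of order $n$ is the graph with $n$ vertices and no edges. *)

theory Defs
  imports "HOL-Analysis.Analysis" "Graph_Theory.Graph_Theory"
begin

text \<open>
  Simple undirected graphs are represented, as usual in Graph_Theory (locale \<^locale>\<open>graph\<close>),
  by symmetric loop-free digraphs without parallel arcs: an edge between A and B is the pair of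
  arcs (A, B) and (B, A).
\<close>

definition discrete_topological_graph :: "'a set \<Rightarrow> 'a set pair_pre_digraph" where
  "discrete_topological_graph X =
     (let V = {A. openin (discrete_topology X) A \<and> A \<noteq> {} \<and> A \<noteq> X}
      in \<lparr> pverts = V, parcs = {(A, B). A \<in> V \<and> B \<in> V \<and> A \<inter> B = {}} \<rparr>)"

definition null_graph :: "nat \<Rightarrow> nat pair_pre_digraph" where
  "null_graph n = \<lparr> pverts = {..<n}, parcs = {} \<rparr>"

lemma graph_discrete_topological_graph:
  assumes "finite X"
  shows "graph (with_proj (discrete_topological_graph X))"
proof -
  let ?V = "{A. openin (discrete_topology X) A \<and> A \<noteq> {} \<and> A \<noteq> X}"
  have fin: "finite ?V"
    by (rule finite_subset[of _ "Pow X"]) (use assms in auto)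
  have "{(A, B). A \<in> ?V \<and> B \<in> ?V \<and> A \<inter> B = {}} \<subseteq> ?V \<times> ?V"
    by auto
  then have "finite {(A, B). A \<in> ?V \<and> B \<in> ?V \<and> A \<inter> B = {}}"
    using fin by (meson finite_SigmaI finite_subset)
  then show ?thesis
    using fin
    by unfold_locales
      (auto simp: discrete_topological_graph_def Let_def symmetric_def sym_def
        arc_to_ends_def)
qed

lemma graph_null_graph: "graph (with_proj (null_graph n))"
  by unfold_locales (auto simp: null_graph_def symmetric_def sym_def)

end

theory Submission
  imports Defs
begin

text \<open>
  The \<open>n\<close> complements of singletons form an independent set: two of them meet because their
  intersection omits at most two of the \<open>n \<ge> 3\<close> points of \<open>X\<close>. In particular each of them is
  nonempty, and since it omits a point it is a vertex. The subgraph induced on them has no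
  arcs, and a finite digraph without arcs is determined up to isomorphism by its number of
  vertices (\<open>digraph_iso_null_graph\<close>).
\<close>

text \<open>
  With no arcs to respect, any bijection of the vertices with \<open>{..<n}\<close> is an isomorphism. The tail
  and head maps of the image digraph are part of the isomorphism, so they must be the two
  projections, even though there is no arc to apply them to.
\<close>
lemma digraph_iso_null_graph:
  assumes "finite (verts H)" and "card (verts H) = n" and "arcs H = {}"
  shows "digraph_iso H (with_proj (null_graph n))"
proof -
  obtain f where f: "bij_betw f (verts H) {..<n}"
    using assms(1,2) by (metis bij_betw_iff_card card_lessThan finite_lessThan)
  define h :: "('a, 'b, nat, nat \<times> nat) digraph_isomorphism" where
    "h = \<lparr> iso_verts = f, iso_arcs = (\<lambda>_. (0, 0)), iso_head = snd, iso_tail = fst \<rparr>"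
  have "wf_digraph H"
    using assms(3) by unfold_locales auto
  then have "pre_digraph.digraph_isomorphism H h"
    using f assms(3) by (simp add: pre_digraph.digraph_isomorphism_def h_def bij_betw_def)
  moreover have "with_proj (null_graph n) = app_iso h H"
    using f assms(3) by (simp add: with_proj_def null_graph_def app_iso_def h_def bij_betw_def)
  ultimately show ?thesis
    unfolding digraph_iso_def by blast
qed

lemma complements_of_points_intersect:
  assumes "card X \<ge> 3"
  shows "(X - {x}) \<inter> (X - {y}) \<noteq> {}"
proof
  assume "(X - {x}) \<inter> (X - {y}) = {}"
  then have "X \<subseteq> {x, y}"
    by blast
  then have "card X \<le> card {x, y}"
    by (intro card_mono) auto
  also have "\<dots> \<le> 2"
    by (simp add: card_insert_if)
  finally show False
    using assms by simp
qed

theorem proposition2p11: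
  fixes X :: "'a set" and n :: nat
  assumes "finite X" and "card X = n" and "n \<ge> 3"
  shows "\<exists>H. induced_subgraph H (with_proj (discrete_topological_graph X)) \<and>
             digraph_iso H (with_proj (null_graph n))"
proof -
  let ?G = "with_proj (discrete_topological_graph X)"
  let ?S = "(\<lambda>x. X - {x}) ` X"
  interpret graph ?G
    using assms(1) by (rule graph_discrete_topological_graph)
  have meet: "(X - {x}) \<inter> (X - {y}) \<noteq> {}" for x y
    by (rule complements_of_points_intersect) (use assms(2,3) in simp)
  have "X - {x} \<noteq> {}" for x
    using meet[of x x] by simp
  then have "?S \<subseteq> verts ?G"
    unfolding discrete_topological_graph_def with_proj_simps Let_def by fastforce
  then have induced: "induced_subgraph (?G \<restriction> ?S) ?G"
    by (rule induced_induce)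
  have "inj_on (\<lambda>x. X - {x}) X"
    by (rule inj_onI) blast
  then have "card ?S = n"
    using assms(2) by (simp add: card_image)
  moreover have "arcs (?G \<restriction> ?S) = {}"
  proof (rule equals0I)
    fix e
    assume "e \<in> arcs (?G \<restriction> ?S)"
    then have "fst e \<in> ?S" and "snd e \<in> ?S" and "fst e \<inter> snd e = {}"
      by (simp_all add: discrete_topological_graph_def Let_def split: prod.splits)
    with meet show False
      by (elim imageE) simp
  qed
  ultimately have "digraph_iso (?G \<restriction> ?S) (with_proj (null_graph n))"
    using assms(1) by (intro digraph_iso_null_graph) auto
  with induced show ?thesis
    by blast
qed

end
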